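(* For every positive integer $k$ there exist systems of constraints $F$ over arbitrarily large numbers $n$ of variables such that: the incidence treewidth of $F$ is $O(k)$; every d-SDNNF circuit computing $F$ has size $(n/k)^{\Omega(k)}$; and every constraint $c$ of $F$ is $O(nk)$-slim for OBDDs, i.e., for every total order $\pi$ of $\mathit{var}(c)$ there is a complete $\pi$-OBDD of width $O(nk)$ computing $c$.
   Context: A system of constraints is a finite conjunction of Boolean functions (constraints) each on a finite set of Boolean variables. Its incidence graph has the constraints and variables as vertices, with an edge between constraint $c$ and variable $x$ iff $x\in\mathit{var}(c)$; the incidence treewidth is the treewidth of this graph. A d-SDNNF circuit is a Boolean circuit with literal inputs and binary $\land$/$\lor$ gates, together with a vtree $\tau$ (rooted binary tree with leaves in bijection with the variables) and a map $\lambda$ from gates to vtree nodes such that $\mathit{var}(D_g)\subseteq\mathit{var}(\lambda(g))$ for all gates $g$ ($D_g$ the subcircuit at $g$, $\mathit{var}(t)$ the variables at leaves below $t$), $\lambda(g)=\lambda(g_1)=\lambda(g_2)$ for every $\lor$-gate $g=g_1\lor g_2$, for every $\land$-gate $g=g_1\land g_2$ the node $\lambda(g)$ has children $t_1,t_2$ with $\lambda(g_i)$ below $t_i$, and for every $\lor$-gate $g_1\lor g_2$ no assignment satisfies both $D_{g_1}$ and $D_{g_2}$. Size is the number of gates and wires. A $\pi$-OBDD is a binary decision diagram (DAG with one source, sinks $0$ and $1$, internal decision nodes labelled by variables with a $0$-child and a $1$-child) in which variables appear at most once and in an order consistent with $\pi$ along every root-to-sink path; it is complete if every such path contains all variables.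 Its width is the maximum number of nodes labelled by the same variable. *)

theory Defs
  imports Complex_Main "HOL-Library.Sublist"
begin

subsection \<open>Systems of constraints\<close>

record 'v constraint =
  cvar :: "'v set"
  cfun :: "('v \<Rightarrow> bool) \<Rightarrow> bool"

text \<open>A Boolean function on \<open>cvar c\<close> is given on total assignments and must ignore all
  variables outside \<open>cvar c\<close>.  It need not depend on every variable in \<open>cvar c\<close>.\<close>

definition is_constraint :: "'v constraint \<Rightarrow> bool" where
  "is_constraint c \<longleftrightarrow> finite (cvar c) \<and>
     (\<forall>a b. (\<forall>x\<in>cvar c. a x = b x) \<longrightarrow> cfun c a = cfun c b)"

definition is_system :: "'v constraint set \<Rightarrow> bool" where
  "is_system F \<longleftrightarrow> finite F \<and> (\<forall>c\<in>F. is_constraint c)"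

definition system_vars :: "'v constraint set \<Rightarrow> 'v set" where
  "system_vars F = (\<Union>c\<in>F. cvar c)"

definition system_sat :: "'v constraint set \<Rightarrow> ('v \<Rightarrow> bool) \<Rightarrow> bool" where
  "system_sat F a \<longleftrightarrow> (\<forall>c\<in>F. cfun c a)"


subsection \<open>Treewidth\<close>

text \<open>Undirected graphs are given by a vertex set and a set of two-element edges.\<close>

definition simple_graph :: "'a set \<Rightarrow> 'a set set \<Rightarrow> bool" where
  "simple_graph V E \<longleftrightarrow> (\<forall>e\<in>E. \<exists>u\<in>V. \<exists>v\<in>V. u \<noteq> v \<and> e = {u, v})"

definition connected_within :: "'a set set \<Rightarrow> 'a set \<Rightarrow> bool" where
  "connected_within E S \<longleftrightarrow> (\<forall>u\<in>S. \<forall>v\<in>S. \<exists>xs. xs \<noteq> [] \<and> hd xs = u \<and> last xs = v \<and>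
     set xs \<subseteq> S \<and> successively (\<lambda>x y. {x, y} \<in> E) xs)"

definition is_cycle :: "'a set set \<Rightarrow> 'a list \<Rightarrow> bool" where
  "is_cycle E xs \<longleftrightarrow> length xs \<ge> 3 \<and> distinct xs \<and>
     successively (\<lambda>x y. {x, y} \<in> E) xs \<and> {last xs, hd xs} \<in> E"

definition is_tree :: "'a set \<Rightarrow> 'a set set \<Rightarrow> bool" where
  "is_tree V E \<longleftrightarrow> finite V \<and> V \<noteq> {} \<and> simple_graph V E \<and> connected_within E V \<and>
     (\<nexists>xs. is_cycle E xs)"

definition is_tree_decomposition ::
    "'a set \<Rightarrow> 'a set set \<Rightarrow> 't set \<Rightarrow> 't set set \<Rightarrow> ('t \<Rightarrow> 'a set) \<Rightarrow> bool" where
  "is_tree_decomposition V E T A bag \<longleftrightarrow> is_tree T A \<and>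
     (\<forall>t\<in>T. bag t \<subseteq> V) \<and>
     (\<forall>v\<in>V. \<exists>t\<in>T. v \<in> bag t) \<and>
     (\<forall>e\<in>E. \<exists>t\<in>T. e \<subseteq> bag t) \<and>
     (\<forall>v\<in>V. connected_within A {t \<in> T. v \<in> bag t})"

definition decomposition_width :: "'t set \<Rightarrow> ('t \<Rightarrow> 'a set) \<Rightarrow> nat" where
  "decomposition_width T bag = Max ((\<lambda>t. card (bag t)) ` T) - 1"

text \<open>Decomposition trees are finite, so natural numbers suffice as their nodes.\<close>

definition treewidth :: "'a set \<Rightarrow> 'a set set \<Rightarrow> nat" where
  "treewidth V E = (LEAST w. \<exists>(T :: nat set) A bag.
     is_tree_decomposition V E T A bag \<and> decomposition_width T bag = w)"

definition incidence_vertices :: "'v constraint set \<Rightarrow> ('v constraint + 'v) set" where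
  "incidence_vertices F = Inl ` F \<union> Inr ` system_vars F"

definition incidence_edges :: "'v constraint set \<Rightarrow> ('v constraint + 'v) set set" where
  "incidence_edges F = {{Inl c, Inr x} | c x. c \<in> F \<and> x \<in> cvar c}"

definition incidence_treewidth :: "'v constraint set \<Rightarrow> nat" where
  "incidence_treewidth F = treewidth (incidence_vertices F) (incidence_edges F)"


subsection \<open>Deterministic structured DNNF circuits\<close>

datatype 'v vtree = VLeaf 'v | VNode "'v vtree" "'v vtree"

fun vtree_leaves :: "'v vtree \<Rightarrow> 'v list" where
  "vtree_leaves (VLeaf x) = [x]"
| "vtree_leaves (VNode l r) = vtree_leaves l @ vtree_leaves r"

text \<open>As the leaves of a vtree are pairwise distinct, its nodes correspond one-to-one to the
  subtrees below them; a node is represented by that subtree, and \<open>s\<close> is below \<open>t\<close> (possibly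
  equal to it) iff \<open>s \<in> subtrees t\<close>.\<close>

fun subtrees :: "'v vtree \<Rightarrow> 'v vtree set" where
  "subtrees (VLeaf x) = {VLeaf x}"
| "subtrees (VNode l r) = insert (VNode l r) (subtrees l \<union> subtrees r)"

definition vtree_on :: "'v set \<Rightarrow> 'v vtree \<Rightarrow> bool" where
  "vtree_on X t \<longleftrightarrow> distinct (vtree_leaves t) \<and> set (vtree_leaves t) = X"

text \<open>\<open>Lit x True\<close> is the literal \<open>x\<close>, \<open>Lit x False\<close> its negation.  There are no constant
  inputs; hence no deterministic structured DNNF circuit computes an unsatisfiable function.\<close>

datatype ('v, 'g) gate = Lit 'v bool | And 'g 'g | Or 'g 'g

fun gate_inputs :: "('v, 'g) gate \<Rightarrow> 'g list" where
  "gate_inputs (Lit x b) = []"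
| "gate_inputs (And g h) = [g, h]"
| "gate_inputs (Or g h) = [g, h]"

record ('v, 'g) circuit =
  gates :: "'g set"
  gate :: "'g \<Rightarrow> ('v, 'g) gate"
  output_gate :: 'g

definition wires :: "('v, 'g) circuit \<Rightarrow> ('g \<times> 'g) set" where
  "wires D = {(h, g). g \<in> gates D \<and> h \<in> set (gate_inputs (gate D g))}"

definition is_circuit :: "('v, 'g) circuit \<Rightarrow> bool" where
  "is_circuit D \<longleftrightarrow> finite (gates D) \<and> output_gate D \<in> gates D \<and>
     (\<forall>g\<in>gates D. set (gate_inputs (gate D g)) \<subseteq> gates D) \<and> acyclic (wires D)"

definition circuit_size :: "('v, 'g) circuit \<Rightarrow> nat" where
  "circuit_size D = card (gates D) + (\<Sum>g\<in>gates D. length (gate_inputs (gate D g)))"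

text \<open>\<open>gate_sat D a g\<close> says that the assignment \<open>a\<close> satisfies the subcircuit at \<open>g\<close>; all gates
  are monotone in their inputs, so the least fixed point is the usual evaluation.\<close>

inductive gate_sat :: "('v, 'g) circuit \<Rightarrow> ('v \<Rightarrow> bool) \<Rightarrow> 'g \<Rightarrow> bool"
  for D :: "('v, 'g) circuit" and a :: "'v \<Rightarrow> bool" where
  "gate D g = Lit x b \<Longrightarrow> a x = b \<Longrightarrow> gate_sat D a g"
| "gate D g = And h1 h2 \<Longrightarrow> gate_sat D a h1 \<Longrightarrow> gate_sat D a h2 \<Longrightarrow> gate_sat D a g"
| "gate D g = Or h1 h2 \<Longrightarrow> gate_sat D a h1 \<Longrightarrow> gate_sat D a g"
| "gate D g = Or h1 h2 \<Longrightarrow> gate_sat D a h2 \<Longrightarrow> gate_sat D a g"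

definition gate_vars :: "('v, 'g) circuit \<Rightarrow> 'g \<Rightarrow> 'v set" where
  "gate_vars D g = {x. \<exists>h b. (h, g) \<in> (wires D)\<^sup>* \<and> gate D h = Lit x b}"

text \<open>The children of a vtree node are unordered, so the two inputs of an \<open>And\<close>-gate may be
  matched with them in either way.\<close>

definition is_d_SDNNF ::
    "'v set \<Rightarrow> ('v, 'g) circuit \<Rightarrow> 'v vtree \<Rightarrow> ('g \<Rightarrow> 'v vtree) \<Rightarrow> bool" where
  "is_d_SDNNF X D \<tau> lam \<longleftrightarrow> is_circuit D \<and> vtree_on X \<tau> \<and>
     (\<forall>g\<in>gates D. lam g \<in> subtrees \<tau> \<and> gate_vars D g \<subseteq> set (vtree_leaves (lam g))) \<and>
     (\<forall>g\<in>gates D. \<forall>g1 g2. gate D g = Or g1 g2 \<longrightarrow> lam g = lam g1 \<and> lam g = lam g2) \<and>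
     (\<forall>g\<in>gates D. \<forall>g1 g2. gate D g = And g1 g2 \<longrightarrow>
        (\<exists>t1 t2. (lam g = VNode t1 t2 \<or> lam g = VNode t2 t1) \<and>
           lam g1 \<in> subtrees t1 \<and> lam g2 \<in> subtrees t2)) \<and>
     (\<forall>g\<in>gates D. \<forall>g1 g2. gate D g = Or g1 g2 \<longrightarrow>
        (\<nexists>a. gate_sat D a g1 \<and> gate_sat D a g2))"

definition d_SDNNF_computes ::
    "('v, 'g) circuit \<Rightarrow> 'v vtree \<Rightarrow> ('g \<Rightarrow> 'v vtree) \<Rightarrow> 'v constraint set \<Rightarrow> bool" where
  "d_SDNNF_computes D \<tau> lam F \<longleftrightarrow> is_d_SDNNF (system_vars F) D \<tau> lam \<and>
     (\<forall>a. gate_sat D a (output_gate D) \<longleftrightarrow> system_sat F a)"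


subsection \<open>Binary decision diagrams\<close>

text \<open>The nodes of a diagram are the two sinks and the decision nodes \<open>Inner v\<close> for
  \<open>v \<in> dnodes B\<close>.\<close>

datatype 'n bdd_node = Sink bool | Inner 'n

record ('v, 'n) bdd =
  dnodes :: "'n set"
  dlabel :: "'n \<Rightarrow> 'v"
  dchild :: "'n \<Rightarrow> bool \<Rightarrow> 'n bdd_node"
  bdd_root :: "'n bdd_node"

definition bdd_edges :: "('v, 'n) bdd \<Rightarrow> ('n \<times> 'n) set" where
  "bdd_edges B = {(u, v). u \<in> dnodes B \<and> (\<exists>b. dchild B u b = Inner v)}"

text \<open>The root is the only source, except that a sink not occurring in the diagram (when it
  computes a constant function) is disregarded.\<close>

definition is_bdd :: "('v, 'n) bdd \<Rightarrow> bool" where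
  "is_bdd B \<longleftrightarrow> finite (dnodes B) \<and> acyclic (bdd_edges B) \<and> Range (bdd_edges B) \<subseteq> dnodes B \<and>
     (\<forall>v. bdd_root B = Inner v \<longrightarrow> v \<in> dnodes B) \<and>
     {v \<in> dnodes B. v \<notin> Range (bdd_edges B)} = {v. bdd_root B = Inner v}"

text \<open>\<open>bdd_path B u p s\<close>: there is a path from \<open>u\<close> to the sink \<open>s\<close> that tests the variables
  \<open>map fst p\<close> in this order, with outcomes \<open>map snd p\<close>.\<close>

inductive bdd_path :: "('v, 'n) bdd \<Rightarrow> 'n bdd_node \<Rightarrow> ('v \<times> bool) list \<Rightarrow> bool \<Rightarrow> bool"
  for B :: "('v, 'n) bdd" where
  "bdd_path B (Sink s) [] s"
| "v \<in> dnodes B \<Longrightarrow> bdd_path B (dchild B v b) p s \<Longrightarrow> bdd_path B (Inner v) ((dlabel B v, b) # p) s"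

text \<open>A total order of a finite set is given as the duplicate-free list of its elements.\<close>

definition is_OBDD :: "'v list \<Rightarrow> ('v, 'n) bdd \<Rightarrow> bool" where
  "is_OBDD \<pi> B \<longleftrightarrow> is_bdd B \<and> (\<forall>p s. bdd_path B (bdd_root B) p s \<longrightarrow> subseq (map fst p) \<pi>)"

definition is_complete_OBDD :: "'v list \<Rightarrow> ('v, 'n) bdd \<Rightarrow> bool" where
  "is_complete_OBDD \<pi> B \<longleftrightarrow> is_OBDD \<pi> B \<and>
     (\<forall>p s. bdd_path B (bdd_root B) p s \<longrightarrow> set \<pi> \<subseteq> fst ` set p)"

definition bdd_accepts :: "('v, 'n) bdd \<Rightarrow> ('v \<Rightarrow> bool) \<Rightarrow> bool" where
  "bdd_accepts B a \<longleftrightarrow> (\<exists>p. bdd_path B (bdd_root B) p True \<and> (\<forall>(x, b)\<in>set p. a x = b))"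

definition bdd_width :: "('v, 'n) bdd \<Rightarrow> nat" where
  "bdd_width B = Max (insert 0 ((\<lambda>x. card {v \<in> dnodes B. dlabel B v = x}) ` dlabel B ` dnodes B))"

definition slim_for_OBDDs :: "nat \<Rightarrow> 'v constraint \<Rightarrow> bool" where
  "slim_for_OBDDs w c \<longleftrightarrow> (\<forall>\<pi>. distinct \<pi> \<and> set \<pi> = cvar c \<longrightarrow>
     (\<exists>B :: ('v, nat) bdd. is_complete_OBDD \<pi> B \<and> bdd_width B \<le> w \<and>
        (\<forall>a. bdd_accepts B a \<longleftrightarrow> cfun c a)))"

end

theory Submission
  imports Defs "HOL-Library.Nat_Bijection" "HOL-Library.FuncSet"
begin

text \<open>
  The variables are \<open>6p\<close> parallel copies of every arc \<open>(i, j)\<close> on \<open>10k\<close> vertices, loops included, and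
  \<open>F\<close> says that the selected arcs form a circulation modulo \<open>p\<close>, with one constraint per vertex. There are
  only \<open>10k\<close> constraints, which bounds the incidence treewidth, and each is decided in any variable order
  by a counter modulo \<open>p\<close>.

  For the lower bound take a vtree node that splits the variables in a balanced way. Call an arc frequent on a
  side if at least \<open>p\<close> of its copies lie there. Subsets of a side then realise, modulo \<open>p\<close>, all integer
  combinations of its frequent arcs. Every arc is frequent on some side, and a graph or its complement is
  connected, so one side realises every vector of excesses with sum zero; by counting, the other side has
  a star of \<open>k\<close> frequent arcs and realises \<open>p\<^sup>k\<close> such vectors. Pairing each of these with its negative gives
  \<open>p\<^sup>k\<close> models no two of which can be recombined across the split. Two models that pass through the
  same gate at the vtree node could be recombined, so there are at least \<open>p\<^sup>k\<close> gates.
\<close>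

section \<open>Incidence treewidth\<close>

lemma star_is_tree: "is_tree {0..n::nat} {{0, t} | t. t \<in> {1..n}}"
proof -
  define A where "A = {{0, t} | t. t \<in> {1..n}}"
  have edge: "{x, y} \<in> A \<longleftrightarrow> (x = 0 \<and> y \<in> {1..n} \<or> y = 0 \<and> x \<in> {1..n})" for x y
    by (auto simp: A_def doubleton_eq_iff)
  have "simple_graph {0..n} A"
    unfolding simple_graph_def
  proof
    fix e assume "e \<in> A"
    then obtain t where "e = {0, t}" "t \<in> {1..n}" unfolding A_def by blast
    then show "\<exists>u\<in>{0..n}. \<exists>v\<in>{0..n}. u \<noteq> v \<and> e = {u, v}"
      by (intro bexI[of _ 0] bexI[of _ t]) auto
  qed
  moreover have "connected_within A {0..n}"
    unfolding connected_within_def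
  proof (intro ballI)
    fix u v assume uv: "u \<in> {0..n}" "v \<in> {0..n}"
    consider "u = v" | "u \<noteq> v" "u = 0 \<or> v = 0" | "u \<noteq> 0" "v \<noteq> 0" by blast
    then show "\<exists>xs. xs \<noteq> [] \<and> hd xs = u \<and> last xs = v \<and> set xs \<subseteq> {0..n} \<and>
      successively (\<lambda>x y. {x, y} \<in> A) xs"
    proof cases
      case 1
      then show ?thesis using uv by (intro exI[of _ "[u]"]) auto
    next
      case 2
      then show ?thesis using uv
        by (intro exI[of _ "[u, v]"]) (simp add: edge, auto)
    next
      case 3
      then show ?thesis using uv
        by (intro exI[of _ "[u, 0, v]"]) (use edge[of u 0] edge[of 0 v] in auto)
    qed
  qed
  moreover have "\<not> is_cycle A xs" for xs
  proof
    assume c: "is_cycle A xs"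
    then have "length xs \<ge> 3" by (simp add: is_cycle_def)
    then obtain a b d ys where xs: "xs = a # b # d # ys"
      by (metis One_nat_def Suc_le_length_iff numeral_3_eq_3)
    show False
    \<comment> \<open>Every edge contains 0. But the edges \<open>{a, b}\<close>,
      \<open>{b, d}\<close>, \<open>{d, a}\<close> of a triangle have no common vertex, and in a
      longer cycle \<open>{a, b}\<close> and \<open>{d, e}\<close> are disjoint.\<close>
    proof (cases ys)
      case Nil
      then show False using c unfolding is_cycle_def xs by (auto simp: edge)
    next
      case (Cons e zs)
      then show False using c unfolding is_cycle_def xs by (auto simp: edge)
    qed
  qed
  ultimately show ?thesis
    unfolding is_tree_def A_def by auto
qed

lemma connected_within_singleton: "connected_within E {t}"
  unfolding connected_within_def by (intro ballI exI[of _ "[t]"]) simp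

text \<open>The constraints cover all edges of the incidence graph. With all of them in every bag, a
  star with one further variable in each leaf is a decomposition.\<close>

lemma incidence_treewidth_le_card:
  assumes "is_system F"
  shows "incidence_treewidth F \<le> card F"
proof -
  have finF: "finite F" and finX: "finite (system_vars F)"
    using assms by (auto simp: is_system_def is_constraint_def system_vars_def)
  define n where "n = card (system_vars F)"
  obtain f where f: "bij_betw f {1..n} (system_vars F)"
    using ex_bij_betw_nat_finite_1[OF finX] n_def by blast
  let ?T = "{0..n}" and ?A = "{{0, t} | t. t \<in> {1..n}}"
  \<comment> \<open>The centre 0 carries no variable; it keeps the tree nonempty even if there are
    no variables at all.\<close>
  define bag where "bag t = Inl ` F \<union> (if t = 0 then {} else {Inr (f t)})" for t :: nat
  have fin: "f t \<in> system_vars F" if "t \<in> {1..n}" for t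
    using f that by (auto simp: bij_betw_def)
  have onto: "\<exists>t\<in>{1..n}. x = f t" if "x \<in> system_vars F" for x
    using f that by (auto simp: bij_betw_def)
  have tree: "is_tree ?T ?A" by (rule star_is_tree)
  have dec: "is_tree_decomposition (incidence_vertices F) (incidence_edges F) ?T ?A bag"
    unfolding is_tree_decomposition_def
  proof (intro conjI ballI)
    show "is_tree ?T ?A" by fact
  next
    fix t assume "t \<in> ?T"
    then show "bag t \<subseteq> incidence_vertices F"
      using fin[of t] by (auto simp: bag_def incidence_vertices_def)
  next
    fix v assume "v \<in> incidence_vertices F"
    then consider c where "v = Inl c" "c \<in> F" | x where "v = Inr x" "x \<in> system_vars F"
      by (auto simp: incidence_vertices_def)
    then show "\<exists>t\<in>?T. v \<in> bag t"
    proof cases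
      case 1
      then show ?thesis by (intro bexI[of _ 0]) (auto simp: bag_def)
    next
      case 2
      then obtain t where "t \<in> {1..n}" "x = f t" using onto by blast
      then show ?thesis using 2 by (intro bexI[of _ t]) (auto simp: bag_def)
    qed
  next
    fix e assume "e \<in> incidence_edges F"
    then obtain c x where e: "e = {Inl c, Inr x}" "c \<in> F" "x \<in> cvar c"
      by (auto simp: incidence_edges_def)
    then have "x \<in> system_vars F" by (auto simp: system_vars_def)
    then obtain t where "t \<in> {1..n}" "x = f t" using onto by blast
    then show "\<exists>t\<in>?T. e \<subseteq> bag t"
      using e by (intro bexI[of _ t]) (auto simp: bag_def)
  next
    fix v assume "v \<in> incidence_vertices F"
    then consider c where "v = Inl c" "c \<in> F" | x where "v = Inr x" "x \<in> system_vars F"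
      by (auto simp: incidence_vertices_def)
    then show "connected_within ?A {t \<in> ?T. v \<in> bag t}"
    proof cases
      case 1
      then have "{t \<in> ?T. v \<in> bag t} = ?T" by (auto simp: bag_def)
      then show ?thesis using tree by (simp add: is_tree_def)
    next
      case 2
      then obtain t where t: "t \<in> {1..n}" "x = f t" using onto by blast
      have "v \<in> bag t' \<longleftrightarrow> t' = t" if "t' \<in> ?T" for t'
      proof -
        have "v \<in> bag t' \<longleftrightarrow> t' \<noteq> 0 \<and> f t' = f t" using 2 t(2) by (auto simp: bag_def)
        also have "\<dots> \<longleftrightarrow> t' = t"
          using inj_on_eq_iff[OF bij_betw_imp_inj_on[OF f], of t' t] that t(1) by auto
        finally show ?thesis .
      qed
      then have "{t \<in> ?T. v \<in> bag t} = {t}" using t(1) by auto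
      then show ?thesis by (simp add: connected_within_singleton)
    qed
  qed
  have card: "card (bag t) \<le> Suc (card F)" for t
  proof -
    have "card (bag t) \<le> card (Inl ` F :: ('a constraint + 'a) set)
        + card (if t = 0 then {} else {Inr (f t) :: 'a constraint + 'a})"
      unfolding bag_def by (rule card_Un_le)
    also have "\<dots> \<le> card F + 1" by (intro add_mono card_image_le finF) auto
    finally show ?thesis by simp
  qed
  have "incidence_treewidth F \<le> decomposition_width ?T bag"
    unfolding incidence_treewidth_def treewidth_def
    by (rule Least_le) (use dec in blast)
  also have "\<dots> \<le> Suc (card F) - 1"
    unfolding decomposition_width_def by (intro diff_le_mono) (use card in \<open>auto intro!: Max.boundedI\<close>)
  finally show ?thesis by simp
qed


section \<open>Slim constraints\<close>

fun reachable_states :: "('v \<Rightarrow> bool \<Rightarrow> nat \<Rightarrow> nat) \<Rightarrow> nat \<Rightarrow> 'v list \<Rightarrow> nat \<Rightarrow> nat set" where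
  "reachable_states \<delta> s0 \<pi> 0 = {s0}"
| "reachable_states \<delta> s0 \<pi> (Suc i) = {\<delta> (\<pi> ! i) b s | b s. s \<in> reachable_states \<delta> s0 \<pi> i}"

text \<open>State \<open>s\<close> before reading the \<open>i\<close>-th variable becomes node \<open>i * p + s\<close>; unreachable states are
  dropped because the root has to be the only source.\<close>

lemma slim_for_OBDDs_automaton:
  fixes \<delta> :: "'v \<Rightarrow> bool \<Rightarrow> nat \<Rightarrow> nat"
  assumes s0: "s0 < p"
    and step: "\<And>x b s. s < p \<Longrightarrow> \<delta> x b s < p"
    and cfun: "\<And>\<pi> a. distinct \<pi> \<Longrightarrow> set \<pi> = cvar c \<Longrightarrow>
       cfun c a \<longleftrightarrow> acc (fold (\<lambda>x. \<delta> x (a x)) \<pi> s0)"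
  shows "slim_for_OBDDs p c"
  unfolding slim_for_OBDDs_def
proof (intro allI impI)
  fix \<pi> :: "'v list" assume \<pi>: "distinct \<pi> \<and> set \<pi> = cvar c"
  define R where "R = reachable_states \<delta> s0 \<pi>"
  have R0: "R 0 = {s0}" and RS: "\<And>i. R (Suc i) = {\<delta> (\<pi> ! i) b s | b s. s \<in> R i}"
    by (simp_all add: R_def)
  have Rlt: "s < p" if "s \<in> R i" for i s
    using that by (induction i arbitrary: s) (auto simp: R0 RS s0 step)
  define L where "L = length \<pi>"
  \<comment> \<open>Past the last variable a state becomes the sink with its verdict, so every path
    tests all of \<open>\<pi>\<close>. For empty \<open>\<pi>\<close> the root is already a
    sink.\<close>
  define node where "node i s = (if i < L then Inner (i * p + s) else Sink (acc s))" for i s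
  define B :: "('v, nat) bdd" where
    "B = \<lparr>dnodes = {i * p + s | i s. i < L \<and> s \<in> R i},
      dlabel = (\<lambda>v. \<pi> ! (v div p)),
      dchild = (\<lambda>v b. node (Suc (v div p)) (\<delta> (\<pi> ! (v div p)) b (v mod p))),
      bdd_root = node 0 s0\<rparr>"
  have sel: "dnodes B = {i * p + s | i s. i < L \<and> s \<in> R i}" "bdd_root B = node 0 s0"
    by (simp_all add: B_def)
  have label: "dlabel B (i * p + s) = \<pi> ! i" if "s < p" for i s
    using that by (simp add: B_def)
  have child: "dchild B (i * p + s) b = node (Suc i) (\<delta> (\<pi> ! i) b s)" if "s < p" for i s b
    using that by (simp add: B_def)
  have edge: "(u, v) \<in> bdd_edges B \<longleftrightarrow> (\<exists>i s b. Suc i < L \<and> s \<in> R i \<and> u = i * p + s \<and>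
      v = Suc i * p + \<delta> (\<pi> ! i) b s)" for u v
  proof
    assume "(u, v) \<in> bdd_edges B"
    then obtain i s b where di: "u = i * p + s" "i < L" "s \<in> R i" "dchild B u b = Inner v"
      by (auto simp: bdd_edges_def sel)
    then have "node (Suc i) (\<delta> (\<pi> ! i) b s) = Inner v" using child Rlt by metis
    then have "Suc i < L" "v = Suc i * p + \<delta> (\<pi> ! i) b s"
      by (simp_all add: node_def split: if_splits)
    then show "\<exists>i s b. Suc i < L \<and> s \<in> R i \<and> u = i * p + s \<and> v = Suc i * p + \<delta> (\<pi> ! i) b s"
      using di by blast
  next
    assume "\<exists>i s b. Suc i < L \<and> s \<in> R i \<and> u = i * p + s \<and> v = Suc i * p + \<delta> (\<pi> ! i) b s"
    then obtain i s b where di: "Suc i < L" "s \<in> R i" "u = i * p + s"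
      "v = Suc i * p + \<delta> (\<pi> ! i) b s" by blast
    then have "dchild B u b = Inner v" using child Rlt by (simp add: node_def)
    moreover have "u \<in> dnodes B" unfolding sel using di Suc_lessD by blast
    ultimately show "(u, v) \<in> bdd_edges B" by (auto simp: bdd_edges_def)
  qed
  have "finite (dnodes B)"
  proof (rule finite_subset)
    show "dnodes B \<subseteq> {..<L * p + p}"
    proof
      fix v assume "v \<in> dnodes B"
      then obtain i s where "v = i * p + s" "i < L" "s < p" using Rlt by (auto simp: sel)
      then show "v \<in> {..<L * p + p}" by (simp add: add_le_less_mono)
    qed
  qed simp
  moreover have "acyclic (bdd_edges B)"
  \<comment> \<open>Node numbers grow along edges because \<open>s < p\<close>; negation turns this
    into the descent that the rule asks for.\<close>
  proof (rule acyclicI_order)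
    fix u v assume "(u, v) \<in> bdd_edges B"
    then obtain i s b where "s \<in> R i" "u = i * p + s" "v = Suc i * p + \<delta> (\<pi> ! i) b s"
      unfolding edge by blast
    then show "- int v < - int u" using Rlt[of s i] by simp
  qed
  moreover have "Range (bdd_edges B) \<subseteq> dnodes B"
  proof
    fix v assume "v \<in> Range (bdd_edges B)"
    then obtain i s b where "Suc i < L" "s \<in> R i" "v = Suc i * p + \<delta> (\<pi> ! i) b s"
      by (auto simp: edge)
    moreover from this have "\<delta> (\<pi> ! i) b s \<in> R (Suc i)" by (auto simp: RS)
    ultimately show "v \<in> dnodes B" unfolding sel by blast
  qed
  moreover have "\<forall>v. bdd_root B = Inner v \<longrightarrow> v \<in> dnodes B"
  proof (intro allI impI)
    fix v assume "bdd_root B = Inner v"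
    then have "v = 0 * p + s0 \<and> 0 < L \<and> s0 \<in> R 0"
      by (simp add: sel node_def R0 split: if_splits)
    then show "v \<in> dnodes B" unfolding sel by blast
  qed
  moreover have "{v \<in> dnodes B. v \<notin> Range (bdd_edges B)} = {v. bdd_root B = Inner v}"
  proof (intro equalityI subsetI)
    fix v assume v: "v \<in> {v \<in> dnodes B. v \<notin> Range (bdd_edges B)}"
    then obtain i s where di: "v = i * p + s" "i < L" "s \<in> R i" by (auto simp: sel)
    \<comment> \<open>A reachable state in a later layer has a predecessor by construction, so only
      the single state of layer 0 can be a source.\<close>
    have "i = 0"
    proof (cases i)
      case (Suc j)
      then obtain b s' where "s' \<in> R j" "s = \<delta> (\<pi> ! j) b s'" using di by (auto simp: RS)
      then have "(j * p + s', v) \<in> bdd_edges B" unfolding edge using di Suc by blast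
      then show ?thesis using v by blast
    qed
    then show "v \<in> {v. bdd_root B = Inner v}"
      using di by (simp add: sel node_def R0)
  next
    fix v assume "v \<in> {v. bdd_root B = Inner v}"
    then have v: "v = s0" "0 < L" by (auto simp: sel node_def split: if_splits)
    have "v \<notin> Range (bdd_edges B)" using v s0 by (auto simp: edge)
    moreover have "v \<in> dnodes B"
      using \<open>\<forall>v. bdd_root B = Inner v \<longrightarrow> v \<in> dnodes B\<close> v by (simp add: sel(2) node_def)
    ultimately show "v \<in> {v \<in> dnodes B. v \<notin> Range (bdd_edges B)}" by blast
  qed
  ultimately have bdd: "is_bdd B" unfolding is_bdd_def by blast
  \<comment> \<open>Downward induction from the sinks: paths from layer \<open>i\<close> are exactly
    the assignments of the remaining variables, and each ends in the verdict of its run.\<close>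
  have path: "bdd_path B (node i s) q r \<longleftrightarrow>
      map fst q = drop i \<pi> \<and> r = acc (fold (\<lambda>(x, b). \<delta> x b) q s)"
    if "i \<le> L" "s \<in> R i" for i s q r
    using that
  proof (induction i arbitrary: s q rule: inc_induct)
    case base
    then show ?case
      by (subst bdd_path.simps) (auto simp: node_def L_def)
  next
    case (step i)
    have in_nodes: "i * p + s \<in> dnodes B" using step by (auto simp: sel)
    have s: "s < p" using step Rlt by blast
    have next_R: "\<delta> (\<pi> ! i) b s \<in> R (Suc i)" for b using step by (auto simp: RS)
    have drop: "drop i \<pi> = \<pi> ! i # drop (Suc i) \<pi>"
      using step by (simp add: L_def Cons_nth_drop_Suc)
    have "bdd_path B (node i s) q r \<longleftrightarrow>
        (\<exists>b q'. q = (\<pi> ! i, b) # q' \<and> bdd_path B (node (Suc i) (\<delta> (\<pi> ! i) b s)) q' r)"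
      using step.hyps in_nodes unfolding node_def[of i]
      by (subst bdd_path.simps) (auto simp: label[OF s] child[OF s])
    also have "\<dots> \<longleftrightarrow> (\<exists>b q'. q = (\<pi> ! i, b) # q' \<and> map fst q' = drop (Suc i) \<pi> \<and>
        r = acc (fold (\<lambda>(x, b). \<delta> x b) q' (\<delta> (\<pi> ! i) b s)))"
      using step.IH[OF next_R] by blast
    also have "\<dots> \<longleftrightarrow> map fst q = drop i \<pi> \<and> r = acc (fold (\<lambda>(x, b). \<delta> x b) q s)"
      unfolding drop by (cases q) auto
    finally show ?case .
  qed
  have path0: "bdd_path B (bdd_root B) q r \<longleftrightarrow>
      map fst q = \<pi> \<and> r = acc (fold (\<lambda>(x, b). \<delta> x b) q s0)" for q r
    using path[of 0 s0] by (simp add: sel R0)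
  have "is_complete_OBDD \<pi> B"
    unfolding is_complete_OBDD_def is_OBDD_def
    using bdd by (auto simp: path0 simp flip: set_map)
  moreover have "bdd_width B \<le> p"
  proof -
    have "card {v \<in> dnodes B. dlabel B v = dlabel B u} \<le> p" if u: "u \<in> dnodes B" for u
    proof -
      obtain i s where di: "u = i * p + s" "i < L" "s \<in> R i" using u by (auto simp: sel)
      \<comment> \<open>The order has no repetitions, so a label determines its layer, which lies in
        a block of \<open>p\<close> consecutive numbers.\<close>
      have "{v \<in> dnodes B. dlabel B v = dlabel B u} \<subseteq> {i * p..<i * p + p}"
      proof
        fix v assume "v \<in> {v \<in> dnodes B. dlabel B v = dlabel B u}"
        then obtain j s' where j: "v = j * p + s'" "j < L" "s' \<in> R j" "dlabel B v = dlabel B u"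
          by (auto simp: sel)
        then have "\<pi> ! j = \<pi> ! i" using di Rlt by (simp add: label)
        then have "j = i" using \<pi> j di by (simp add: L_def nth_eq_iff_index_eq)
        then show "v \<in> {i * p..<i * p + p}" using j Rlt by auto
      qed
      then have "card {v \<in> dnodes B. dlabel B v = dlabel B u} \<le> card {i * p..<i * p + p}"
        by (intro card_mono) auto
      then show ?thesis by simp
    qed
    then show ?thesis
      unfolding bdd_width_def using \<open>finite (dnodes B)\<close> by (subst Max_le_iff) auto
  qed
  moreover have "bdd_accepts B a \<longleftrightarrow> cfun c a" for a
  proof -
    have eq: "map fst q = \<pi> \<and> (\<forall>(x, b)\<in>set q. a x = b) \<longleftrightarrow> q = map (\<lambda>x. (x, a x)) \<pi>" for q
    proof
      assume *: "map fst q = \<pi> \<and> (\<forall>(x, b)\<in>set q. a x = b)"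
      then have "map (\<lambda>x. (x, a x)) \<pi> = map (\<lambda>z. (fst z, a (fst z))) q" by auto
      also have "\<dots> = q" using * by (intro map_idI) auto
      finally show "q = map (\<lambda>x. (x, a x)) \<pi>" ..
    qed (auto simp: comp_def)
    have "bdd_accepts B a \<longleftrightarrow> (\<exists>q. (map fst q = \<pi> \<and> (\<forall>(x, b)\<in>set q. a x = b)) \<and>
        acc (fold (\<lambda>(x, b). \<delta> x b) q s0))"
      unfolding bdd_accepts_def path0 by blast
    also have "\<dots> \<longleftrightarrow> acc (fold (\<lambda>(x, b). \<delta> x b) (map (\<lambda>x. (x, a x)) \<pi>) s0)"
      unfolding eq by simp
    also have "\<dots> \<longleftrightarrow> cfun c a" using cfun[of \<pi> a] \<pi> by (simp add: fold_map comp_def)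
    finally show ?thesis .
  qed
  ultimately show "\<exists>B :: ('v, nat) bdd. is_complete_OBDD \<pi> B \<and> bdd_width B \<le> p \<and>
      (\<forall>a. bdd_accepts B a \<longleftrightarrow> cfun c a)" by blast
qed

text \<open>The state is the partial sum modulo \<open>p\<close>. A sum does not depend on the order
  of its terms, so one automaton serves all variable orders.\<close>

lemma slim_for_OBDDs_modular_sum:
  fixes w :: "'v \<Rightarrow> int"
  assumes "p > 0"
    and cfun: "\<And>a. cfun c a \<longleftrightarrow> int p dvd (\<Sum>x\<in>cvar c. if a x then w x else 0)"
  shows "slim_for_OBDDs p c"
proof -
  \<comment> \<open>Weights may be negative; reducing in the integers first gives a residue from 0
    to \<open>p - 1\<close>.\<close>
  define \<delta> where "\<delta> x b s = nat ((int s + (if b then w x else 0)) mod int p)" for x b s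
  have fold: "int (fold (\<lambda>x. \<delta> x (a x)) \<pi> s) mod int p
      = (int s + (\<Sum>x\<in>set \<pi>. if a x then w x else 0)) mod int p"
    if "distinct \<pi>" for \<pi> a s
    using that
  proof (induction \<pi> arbitrary: s)
    case (Cons y \<pi>)
    have "int (\<delta> y (a y) s) = (int s + (if a y then w y else 0)) mod int p"
      using \<open>p > 0\<close> by (simp add: \<delta>_def)
    then show ?case using Cons by (simp add: mod_add_left_eq add.assoc)
  qed simp
  show ?thesis
  proof (rule slim_for_OBDDs_automaton[where \<delta> = \<delta> and ?s0.0 = 0 and acc = "\<lambda>s. int p dvd int s"])
    show "\<delta> x b s < p" for x b s using \<open>p > 0\<close> by (simp add: \<delta>_def nat_less_iff)
  next
    fix \<pi> a assume "distinct \<pi>" "set \<pi> = cvar c"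
    then show "cfun c a \<longleftrightarrow> int p dvd int (fold (\<lambda>x. \<delta> x (a x)) \<pi> 0)"
      unfolding cfun dvd_eq_mod_eq_0 fold[OF \<open>distinct \<pi>\<close>] by simp
  qed (use \<open>p > 0\<close> in simp)
qed


section \<open>Fooling sets for structured circuits\<close>

lemma subtree_leaves: "s \<in> subtrees t \<Longrightarrow> set (vtree_leaves s) \<subseteq> set (vtree_leaves t)"
  by (induction t) auto

lemma subtrees_refl: "t \<in> subtrees t"
  by (cases t) auto

lemma subtree_distinct:
  "s \<in> subtrees t \<Longrightarrow> distinct (vtree_leaves t) \<Longrightarrow> distinct (vtree_leaves s)"
  by (induction t) auto

text \<open>Subtrees on opposite sides of an inner node share no leaf because leaves are distinct;
  otherwise one of the two is the whole tree or both lie in the same child.\<close>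

lemma subtrees_nested_or_disjoint:
  assumes "distinct (vtree_leaves u)" "s \<in> subtrees u" "t \<in> subtrees u"
  shows "s \<in> subtrees t \<or> t \<in> subtrees s \<or> set (vtree_leaves s) \<inter> set (vtree_leaves t) = {}"
  using assms
proof (induction u)
  case (VNode l r)
  have "set (vtree_leaves v) \<inter> set (vtree_leaves v') = {}"
    if "v \<in> subtrees l" "v' \<in> subtrees r" for v v'
    using VNode.prems(1) subtree_leaves[OF that(1)] subtree_leaves[OF that(2)] by auto
  then show ?case using VNode by auto
qed simp

text \<open>Descend into a child with more than \<open>2 * n / 3\<close> leaves while there is one;
  after that, the larger child fits. \<open>n\<close> is kept apart from the number of leaves of
  \<open>u\<close> so that the thresholds stay fixed in the induction, and \<open>n \<ge> 2\<close>
  prevents the descent from reaching a single leaf.\<close>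

lemma balanced_subtree:
  assumes "n \<ge> 2" "2 * n < 3 * length (vtree_leaves u)"
  shows "\<exists>t\<in>subtrees u. n \<le> 3 * length (vtree_leaves t) \<and> 3 * length (vtree_leaves t) \<le> 2 * n"
  using assms(2)
proof (induction u)
  case (VLeaf x)
  then show ?case using assms(1) by simp
next
  case (VNode l r)
  consider "2 * n < 3 * length (vtree_leaves l)" | "2 * n < 3 * length (vtree_leaves r)"
    | "3 * length (vtree_leaves l) \<le> 2 * n" "n \<le> 3 * length (vtree_leaves l)"
    | "3 * length (vtree_leaves r) \<le> 2 * n" "n \<le> 3 * length (vtree_leaves r)"
    using VNode.prems by force
  then show ?case
    using VNode.IH by cases (use subtrees_refl[of l] subtrees_refl[of r] in auto)
qed

section \<open>Recombining satisfying assignments at a vtree node\<close>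

lemma gate_input_in_gates:
  "is_circuit D \<Longrightarrow> g \<in> gates D \<Longrightarrow> h \<in> set (gate_inputs (gate D g)) \<Longrightarrow> h \<in> gates D"
  by (auto simp: is_circuit_def)

lemma gate_vars_input:
  assumes "g \<in> gates D" "h \<in> set (gate_inputs (gate D g))"
  shows "gate_vars D h \<subseteq> gate_vars D g"
proof -
  have "(h, g) \<in> wires D" using assms by (simp add: wires_def)
  then show ?thesis unfolding gate_vars_def by (auto intro: rtrancl_into_rtrancl)
qed

lemma gate_sat_cong:
  assumes "is_circuit D" "gate_sat D a g" "g \<in> gates D" "\<And>x. x \<in> gate_vars D g \<Longrightarrow> a x = b x"
  shows "gate_sat D b g"
  using assms(2-4)
proof (induction rule: gate_sat.induct)
  case (1 g x v)
  then have "x \<in> gate_vars D g" by (auto simp: gate_vars_def)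
  then show ?case using 1 gate_sat.intros(1) by metis
next
  case (2 g h1 h2)
  then have "h1 \<in> gates D" "h2 \<in> gates D" using gate_input_in_gates[OF assms(1)] by auto
  then show ?case using 2 gate_vars_input[of g D h1] gate_vars_input[of g D h2]
    by (intro gate_sat.intros(2)[OF 2(1)]) auto
next
  case (3 g h1 h2)
  then have "h1 \<in> gates D" using gate_input_in_gates[OF assms(1)] by auto
  then show ?case using 3 gate_vars_input[of g D h1]
    by (intro gate_sat.intros(3)[OF 3(1)]) auto
next
  case (4 g h1 h2)
  then have "h2 \<in> gates D" using gate_input_in_gates[OF assms(1)] by auto
  then show ?case using 4 gate_vars_input[of g D h2]
    by (intro gate_sat.intros(4)[OF 4(1)]) auto
qed

text \<open>The gate \<open>h\<close> is where the path that a satisfying assignment traces towards the vtree node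
  \<open>t\<close> leaves the proper ancestors of \<open>t\<close> or ends in a literal; everything hanging off that path has no variables
  below \<open>t\<close>.\<close>

lemma d_SDNNF_exchange:
  assumes D: "is_d_SDNNF X D \<tau> lam" and t: "t \<in> subtrees \<tau>"
    and "gate_sat D a g" "g \<in> gates D"
  shows "\<exists>h\<in>gates D. gate_sat D a h \<and> (\<forall>b. gate_sat D b h \<longrightarrow>
    gate_sat D (\<lambda>x. if x \<in> set (vtree_leaves t) then b x else a x) g)"
proof -
  have circ: "is_circuit D" and dist: "distinct (vtree_leaves \<tau>)"
    and lam: "\<And>g. g \<in> gates D \<Longrightarrow> lam g \<in> subtrees \<tau>"
    and vars: "\<And>g. g \<in> gates D \<Longrightarrow> gate_vars D g \<subseteq> set (vtree_leaves (lam g))"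
    using D by (auto simp: is_d_SDNNF_def vtree_on_def)
  show ?thesis using assms(3,4)
  proof (induction rule: gate_sat.induct)
    case (1 g x v)
    \<comment> \<open>A literal is its own witness: \<open>a\<close> and every \<open>b\<close> that
      satisfies it agree on its variable, hence so does the mixture.\<close>
    have "gate_sat D b g \<longleftrightarrow> b x = v" for b
      using 1 by (subst gate_sat.simps) auto
    then show ?case using 1 by (intro bexI[of _ g]) auto
  next
    case (2 g h1 h2)
    note eq = 2(1) and sat1 = "2.hyps"(2) and sat2 = "2.hyps"(3)
      and IH1 = "2.IH"(1) and IH2 = "2.IH"(2) and g = "2.prems"
    let ?T = "set (vtree_leaves t)"
    have h: "h1 \<in> gates D" "h2 \<in> gates D" using gate_input_in_gates[OF circ g] eq by auto
    have sat: "gate_sat D a g" using eq sat1 sat2 by (rule gate_sat.intros(2))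
    have off: "gate_sat D (\<lambda>x. if x \<in> ?T then b x else a x) h"
      if "gate_sat D a h" "h \<in> gates D" "gate_vars D h \<inter> ?T = {}" for b h
      using that by (intro gate_sat_cong[OF circ that(1,2)]) auto
    obtain t1 t2 where node: "lam g = VNode t1 t2 \<or> lam g = VNode t2 t1"
      and sub: "lam h1 \<in> subtrees t1" "lam h2 \<in> subtrees t2"
      using D g eq unfolding is_d_SDNNF_def by meson
    have v1: "gate_vars D h1 \<subseteq> set (vtree_leaves t1)" and v2: "gate_vars D h2 \<subseteq> set (vtree_leaves t2)"
      using vars h sub subtree_leaves by blast+
    have "distinct (vtree_leaves (lam g))" using subtree_distinct lam dist g by blast
    then have disj: "set (vtree_leaves t1) \<inter> set (vtree_leaves t2) = {}" using node by auto
    \<comment> \<open>If \<open>lam g\<close> lies at or below \<open>t\<close>, the mixture agrees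
      with \<open>b\<close> on the variables of \<open>g\<close>; if it is disjoint from
      \<open>t\<close>, with \<open>a\<close>. In both cases \<open>g\<close> is the witness. Above
      \<open>t\<close>, the witness comes from the conjunct on whose side \<open>t\<close>
      lies.\<close>
    consider "lam g \<in> subtrees t" | "set (vtree_leaves (lam g)) \<inter> ?T = {}"
      | "t \<in> subtrees (lam g)" "lam g \<noteq> t"
      using subtrees_nested_or_disjoint[OF dist lam[OF g] t] subtrees_refl[of t] by blast
    then show ?case
    proof cases
      case 1
      then have sub: "gate_vars D g \<subseteq> ?T" using subtree_leaves vars g by blast
      then have "gate_sat D (\<lambda>x. if x \<in> ?T then b x else a x) g" if "gate_sat D b g" for b
        using that g by (intro gate_sat_cong[OF circ that]) auto
      then show ?thesis using g sat by blast
    next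
      case 2
      then have "gate_vars D g \<inter> ?T = {}" using vars g by blast
      then show ?thesis using off sat g by blast
    next
      case 3
      then consider "t \<in> subtrees t1" | "t \<in> subtrees t2" using node by auto
      then show ?thesis
      proof cases
        case 1
        then have "gate_vars D h2 \<inter> ?T = {}" using subtree_leaves[of t t1] v2 disj by blast
        then show ?thesis
          using IH1[OF h(1)] off[OF sat2 h(2)] gate_sat.intros(2)[OF eq] by blast
      next
        case 2
        then have "gate_vars D h1 \<inter> ?T = {}" using subtree_leaves[of t t2] v1 disj by blast
        then show ?thesis
          using IH2[OF h(2)] off[OF sat1 h(1)] gate_sat.intros(2)[OF eq] by blast
      qed
    qed
  next
    case (3 g h1 h2)
    then have "h1 \<in> gates D" using gate_input_in_gates[OF circ] by auto
    then show ?case using 3 gate_sat.intros(3)[OF 3(1)] by blast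
  next
    case (4 g h1 h2)
    then have "h2 \<in> gates D" using gate_input_in_gates[OF circ] by auto
    then show ?case using 4 gate_sat.intros(4)[OF 4(1)] by blast
  qed
qed

text \<open>Each \<open>v\<close> gets the gate given by the exchange lemma. If \<open>v\<close> and
  \<open>w\<close> got the same one, \<open>\<sigma> w\<close> could replace
  \<open>\<sigma> v\<close> below \<open>t\<close>, which \<open>fool\<close> excludes for distinct
  elements.\<close>

lemma d_SDNNF_fooling_set:
  assumes D: "is_d_SDNNF X D \<tau> lam" and t: "t \<in> subtrees \<tau>"
    and sat: "\<And>v. v \<in> V \<Longrightarrow> gate_sat D (\<sigma> v) (output_gate D)"
    and fool: "\<And>v w. v \<in> V \<Longrightarrow> w \<in> V \<Longrightarrow> gate_sat D
      (\<lambda>x. if x \<in> set (vtree_leaves t) then \<sigma> w x else \<sigma> v x) (output_gate D) \<Longrightarrow> v = w"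
  shows "card V \<le> card (gates D)"
proof -
  have out: "output_gate D \<in> gates D" and fin: "finite (gates D)"
    using D by (auto simp: is_d_SDNNF_def is_circuit_def)
  let ?mix = "\<lambda>b a x. if x \<in> set (vtree_leaves t) then b x else a x"
  have "\<forall>v\<in>V. \<exists>h. h \<in> gates D \<and> gate_sat D (\<sigma> v) h \<and>
      (\<forall>b. gate_sat D b h \<longrightarrow> gate_sat D (?mix b (\<sigma> v)) (output_gate D))"
    using d_SDNNF_exchange[OF D t sat out] by blast
  from bchoice[OF this] obtain h where h: "\<forall>v\<in>V. h v \<in> gates D \<and> gate_sat D (\<sigma> v) (h v) \<and>
      (\<forall>b. gate_sat D b (h v) \<longrightarrow> gate_sat D (?mix b (\<sigma> v)) (output_gate D))" ..
  have "inj_on h V"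
  proof (rule inj_onI)
    fix v w assume vw: "v \<in> V" "w \<in> V" "h v = h w"
    then have "gate_sat D (\<sigma> w) (h v)" using h by simp
    then show "v = w" using fool vw(1,2) h by blast
  qed
  moreover have "h ` V \<subseteq> gates D" using h by blast
  ultimately show ?thesis using fin by (rule card_inj_on_le)
qed


section \<open>Circulations modulo \<open>p\<close>\<close>

text \<open>The column of an arc in the signed incidence matrix: 1 at its tail, -1 at its head, and
  zero throughout for a loop.\<close>

definition excess :: "nat \<Rightarrow> nat \<times> nat \<Rightarrow> int" where
  "excess r e = of_bool (r = fst e) - of_bool (r = snd e)"

text \<open>All constraints share the scope \<open>X\<close>; an arc that misses \<open>r\<close>
  contributes 0.\<close>

definition conservation :: "'v set \<Rightarrow> ('v \<Rightarrow> nat \<times> nat) \<Rightarrow> nat \<Rightarrow> nat \<Rightarrow> 'v constraint" where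
  "conservation X ty p r =
     \<lparr>cvar = X, cfun = \<lambda>a. int p dvd (\<Sum>x\<in>X. if a x then excess r (ty x) else 0)\<rparr>"

definition circulation_system ::
    "'v set \<Rightarrow> ('v \<Rightarrow> nat \<times> nat) \<Rightarrow> nat \<Rightarrow> nat \<Rightarrow> 'v constraint set" where
  "circulation_system X ty p q = conservation X ty p ` {..<q}"

lemma is_system_circulation: "finite X \<Longrightarrow> is_system (circulation_system X ty p q)"
  by (auto simp: is_system_def circulation_system_def is_constraint_def conservation_def
      intro!: arg_cong[where f = "(dvd) _"] sum.cong)

lemma system_vars_circulation: "q > 0 \<Longrightarrow> system_vars (circulation_system X ty p q) = X"
  by (auto simp: system_vars_def circulation_system_def conservation_def)

lemma system_sat_circulation:
  assumes "finite X"
  shows "system_sat (circulation_system X ty p q) a \<longleftrightarrow>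
    (\<forall>r<q. int p dvd (\<Sum>x\<in>{x \<in> X. a x}. excess r (ty x)))"
  using assms
  by (auto simp: system_sat_def circulation_system_def conservation_def sum.inter_filter)

lemma slim_circulation:
  "p > 0 \<Longrightarrow> c \<in> circulation_system X ty p q \<Longrightarrow> slim_for_OBDDs p c"
  by (auto simp: circulation_system_def conservation_def
      intro!: slim_for_OBDDs_modular_sum[where w = "\<lambda>x. excess _ (ty x)"])

section \<open>Excess vectors realised on one side\<close>

text \<open>Select \<open>c e mod p\<close> of the at least \<open>p\<close> copies of each
  \<open>e\<close>. Copies of different arcs are disjoint, and reducing a coefficient modulo
  \<open>p\<close> changes the sum by a multiple of \<open>p\<close>. The same selection works for
  all \<open>r\<close>.\<close>

lemma residue_combination:
  fixes f :: "'r \<Rightarrow> 'e \<Rightarrow> int"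
  assumes "finite Y" "finite A" "p > 0"
    and copies: "\<And>e. e \<in> A \<Longrightarrow> p \<le> card {x \<in> Y. ty x = e}"
  shows "\<exists>S\<subseteq>Y. \<forall>r. int p dvd (\<Sum>x\<in>S. f r (ty x)) - (\<Sum>e\<in>A. c e * f r e)"
proof -
  have "\<exists>T. T \<subseteq> {x \<in> Y. ty x = e} \<and> card T = nat (c e mod int p)" if "e \<in> A" for e
  proof -
    have "nat (c e mod int p) \<le> p" using \<open>p > 0\<close> by (simp add: nat_le_iff less_imp_le)
    then have "nat (c e mod int p) \<le> card {x \<in> Y. ty x = e}" using copies[OF that] by simp
    then show ?thesis by (rule obtain_subset_with_card_n) blast
  qed
  then obtain T where T: "\<And>e. e \<in> A \<Longrightarrow> T e \<subseteq> {x \<in> Y. ty x = e}"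
    "\<And>e. e \<in> A \<Longrightarrow> card (T e) = nat (c e mod int p)" by metis
  have "(\<Sum>x\<in>(\<Union>e\<in>A. T e). f r (ty x)) = (\<Sum>e\<in>A. (c e mod int p) * f r e)" for r
  proof -
    have "(\<Sum>x\<in>(\<Union>e\<in>A. T e). f r (ty x)) = (\<Sum>e\<in>A. \<Sum>x\<in>T e. f r (ty x))"
    proof (intro sum.UNION_disjoint ballI impI)
      show "finite (T e)" if "e \<in> A" for e using T(1)[OF that] assms(1) by (auto intro: finite_subset)
      show "T e \<inter> T e' = {}" if "e \<in> A" "e' \<in> A" "e \<noteq> e'" for e e'
        using T(1)[OF that(1)] T(1)[OF that(2)] that(3) by blast
    qed (use assms in auto)
    also have "\<dots> = (\<Sum>e\<in>A. (c e mod int p) * f r e)"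
    proof (rule sum.cong[OF refl])
      fix e assume "e \<in> A"
      then have "(\<Sum>x\<in>T e. f r (ty x)) = (\<Sum>x\<in>T e. f r e)" using T(1) by (intro sum.cong) auto
      then show "(\<Sum>x\<in>T e. f r (ty x)) = (c e mod int p) * f r e"
        using T(2)[OF \<open>e \<in> A\<close>] \<open>p > 0\<close> by simp
    qed
    finally show ?thesis .
  qed
  moreover have "int p dvd (\<Sum>e\<in>A. (c e mod int p) * f r e) - (\<Sum>e\<in>A. c e * f r e)" for r
    unfolding sum_subtractf[symmetric] left_diff_distrib[symmetric]
    by (intro dvd_sum dvd_mult2) (simp add: mod_eq_dvd_iff[symmetric])
  ultimately show ?thesis using T(1) by (intro exI[of _ "\<Union>e\<in>A. T e"]) auto
qed

text \<open>For finite \<open>A\<close> this is connectivity of \<open>i\<close> and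
  \<open>j\<close> in the undirected graph of \<open>A\<close>, put algebraically so that no paths
  have to be handled.\<close>

definition spans :: "(nat \<times> nat) set \<Rightarrow> nat \<Rightarrow> nat \<Rightarrow> bool" where
  "spans A i j \<longleftrightarrow> (\<exists>c. \<forall>r. excess r (i, j) = (\<Sum>e\<in>A. c e * excess r e))"

lemma spans_arc:
  assumes "finite A" "(i, j) \<in> A"
  shows "spans A i j"
  unfolding spans_def
proof (intro exI allI)
  fix r
  have "(\<Sum>e\<in>A. of_bool (e = (i, j)) * excess r e) = (\<Sum>e\<in>A. if e = (i, j) then excess r e else 0)"
    by (intro sum.cong) auto
  then show "excess r (i, j) = (\<Sum>e\<in>A. of_bool (e = (i, j)) * excess r e)"
    using assms by simp
qed

lemma spans_sym: "spans A i j \<Longrightarrow> spans A j i"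
  unfolding spans_def
proof (elim exE)
  fix c assume *: "\<forall>r. excess r (i, j) = (\<Sum>e\<in>A. c e * excess r e)"
  have "excess r (j, i) = - excess r (i, j)" for r by (simp add: excess_def)
  then show "\<exists>c. \<forall>r. excess r (j, i) = (\<Sum>e\<in>A. c e * excess r e)"
    using * by (intro exI[of _ "\<lambda>e. - c e"]) (simp add: sum_negf)
qed

lemma spans_trans: "spans A i j \<Longrightarrow> spans A j l \<Longrightarrow> spans A i l"
  unfolding spans_def
proof (elim exE)
  fix c d assume *: "\<forall>r. excess r (i, j) = (\<Sum>e\<in>A. c e * excess r e)"
    "\<forall>r. excess r (j, l) = (\<Sum>e\<in>A. d e * excess r e)"
  have "excess r (i, l) = excess r (i, j) + excess r (j, l)" for r by (simp add: excess_def)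
  then show "\<exists>c. \<forall>r. excess r (i, l) = (\<Sum>e\<in>A. c e * excess r e)"
    using * by (intro exI[of _ "\<lambda>e. c e + d e"]) (simp add: sum.distrib ring_distribs)
qed

text \<open>A graph or its complement is connected.\<close>

lemma spans_dichotomy:
  assumes "finite A" "finite B" "Q \<times> Q \<subseteq> A \<union> B"
  shows "(\<forall>i\<in>Q. \<forall>j\<in>Q. spans A i j) \<or> (\<forall>i\<in>Q. \<forall>j\<in>Q. spans B i j)"
proof (rule disjCI)
  assume "\<not> (\<forall>i\<in>Q. \<forall>j\<in>Q. spans B i j)"
  then obtain u v where uv: "u \<in> Q" "v \<in> Q" "\<not> spans B u v" by blast
  have edge: "spans A i j" if "i \<in> Q" "j \<in> Q" "\<not> spans B i j" for i j
    using that assms spans_arc by blast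
  show "\<forall>i\<in>Q. \<forall>j\<in>Q. spans A i j"
  proof (intro ballI)
    fix i j assume ij: "i \<in> Q" "j \<in> Q"
    show "spans A i j"
    proof (cases "spans B i j")
      case True
      \<comment> \<open>As \<open>u\<close> and \<open>v\<close> are in different classes of
        \<open>B\<close>, one of them is outside the common class of \<open>i\<close> and
        \<open>j\<close>. Both steps of the detour through it are arcs of \<open>A\<close>.\<close>
      obtain z where z: "z \<in> Q" "\<not> spans B i z"
        using uv ij by (meson spans_sym spans_trans)
      then have "\<not> spans B z j" using True spans_sym spans_trans by meson
      then show ?thesis using edge z ij spans_trans by blast
    qed (use edge ij in blast)
  qed
qed

text \<open>\<open>S v\<close> realises the combination of the star arcs with coefficients
  \<open>v\<close>, and \<open>U v\<close> realises its negative through \<open>B\<close>. Mixing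
  \<open>S v\<close> with \<open>U w\<close> leaves the difference of two combinations, from which
  \<open>v - w\<close> can be read off at the leaves of the star.\<close>

lemma star_fooling_family:
  assumes fin: "finite Y" "finite Z" "finite A" "finite B" and p: "p > 0"
    and A: "\<And>e. e \<in> A \<Longrightarrow> p \<le> card {x \<in> Y. ty x = e}"
    and B: "\<And>e. e \<in> B \<Longrightarrow> p \<le> card {x \<in> Z. ty x = e}"
    and J: "finite J" "i \<notin> J" "\<And>j. j \<in> J \<Longrightarrow> (i, j) \<in> A" "\<And>j. j \<in> J \<Longrightarrow> spans B i j"
  shows "\<exists>S U. \<forall>v\<in>(\<Pi>\<^sub>E j\<in>J. {..<p}). S v \<subseteq> Y \<and> U v \<subseteq> Z \<and>
      (\<forall>r. int p dvd (\<Sum>x\<in>S v. excess r (ty x)) + (\<Sum>x\<in>U v. excess r (ty x))) \<and>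
      (\<forall>w\<in>(\<Pi>\<^sub>E j\<in>J. {..<p}). (\<forall>r\<in>J. int p dvd
        (\<Sum>x\<in>S v. excess r (ty x)) + (\<Sum>x\<in>U w. excess r (ty x))) \<longrightarrow> v = w)"
proof -
  define f where "f v r = (\<Sum>j\<in>J. int (v j) * excess r (i, j))" for v :: "nat \<Rightarrow> nat" and r
  \<comment> \<open>A leaf \<open>r\<close> of the star is the head of the single arc
    \<open>(i, r)\<close>, and it is no tail since \<open>i\<close> is not in
    \<open>J\<close>.\<close>
  have f_J: "f v r = - int (v r)" if "r \<in> J" for v r
  proof -
    have "f v r = (\<Sum>j\<in>J. if j = r then - int (v j) else 0)"
      unfolding f_def using J(2) that by (intro sum.cong) (auto simp: excess_def)
    then show ?thesis using J(1) that by simp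
  qed
  have "\<exists>S\<subseteq>Y. \<forall>r. int p dvd (\<Sum>x\<in>S. excess r (ty x)) - f v r" for v
  proof -
    have "(\<Sum>e\<in>A. (if e \<in> Pair i ` J then int (v (snd e)) else 0) * excess r e) = f v r" for r
    proof -
      have "(\<Sum>e\<in>A. (if e \<in> Pair i ` J then int (v (snd e)) else 0) * excess r e)
        = (\<Sum>e\<in>Pair i ` J. int (v (snd e)) * excess r e)"
        using fin J(3) by (intro sum.mono_neutral_cong_right) auto
      also have "\<dots> = f v r" unfolding f_def by (subst sum.reindex) (auto simp: inj_on_def)
      finally show ?thesis .
    qed
    then show ?thesis
      using residue_combination[of Y A p ty excess
          "\<lambda>e. if e \<in> Pair i ` J then int (v (snd e)) else 0"] fin p A by auto
  qed
  then obtain S where S: "\<And>v. S v \<subseteq> Y" "\<And>v r. int p dvd (\<Sum>x\<in>S v. excess r (ty x)) - f v r"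
    by metis
  obtain c where c: "\<And>j r. j \<in> J \<Longrightarrow> excess r (i, j) = (\<Sum>e\<in>B. c j e * excess r e)"
    using J(4) unfolding spans_def by metis
  have "\<exists>U\<subseteq>Z. \<forall>r. int p dvd (\<Sum>x\<in>U. excess r (ty x)) + f v r" for v
  proof -
    \<comment> \<open>Expand every star arc over \<open>B\<close> and exchange the two sums.\<close>
    have "(\<Sum>e\<in>B. (- (\<Sum>j\<in>J. int (v j) * c j e)) * excess r e) = - f v r" for r
    proof -
      have "f v r = (\<Sum>j\<in>J. \<Sum>e\<in>B. int (v j) * c j e * excess r e)"
        unfolding f_def by (intro sum.cong) (auto simp: c sum_distrib_left mult.assoc)
      also have "\<dots> = (\<Sum>e\<in>B. (\<Sum>j\<in>J. int (v j) * c j e) * excess r e)"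
        by (subst sum.swap) (simp add: sum_distrib_right)
      finally show ?thesis by (simp add: sum_negf)
    qed
    then show ?thesis
      using residue_combination[of Z B p ty excess "\<lambda>e. - (\<Sum>j\<in>J. int (v j) * c j e)"] fin p B
      by auto
  qed
  then obtain U where U: "\<And>v. U v \<subseteq> Z" "\<And>v r. int p dvd (\<Sum>x\<in>U v. excess r (ty x)) + f v r"
    by metis
  show ?thesis
  proof (rule exI[of _ S], rule exI[of _ U], intro ballI conjI allI impI)
    fix v r show "S v \<subseteq> Y" "U v \<subseteq> Z" by (rule S U)+
    show "int p dvd (\<Sum>x\<in>S v. excess r (ty x)) + (\<Sum>x\<in>U v. excess r (ty x))"
      using dvd_add[OF S(2)[of r v] U(2)[of r v]] by simp
  next
    fix v w assume v: "v \<in> (\<Pi>\<^sub>E j\<in>J. {..<p})" and w: "w \<in> (\<Pi>\<^sub>E j\<in>J. {..<p})"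
      and dvd: "\<forall>r\<in>J. int p dvd (\<Sum>x\<in>S v. excess r (ty x)) + (\<Sum>x\<in>U w. excess r (ty x))"
    show "v = w"
    proof (rule PiE_ext[OF v w])
      fix r assume r: "r \<in> J"
      \<comment> \<open>Both realisation errors are multiples of \<open>p\<close>; subtracting the
        mixed sum from their total cancels the selected copies.\<close>
      have "int p dvd f w r - f v r"
        using dvd_diff[OF dvd_add[OF S(2)[of r v] U(2)[of r w]] dvd[rule_format, OF r]] by simp
      then have "int (v r) mod int p = int (w r) mod int p"
        by (simp add: f_J[OF r] mod_eq_dvd_iff)
      moreover have "v r < p" "w r < p" using v w r by auto
      ultimately show "v r = w r" by simp
    qed
  qed
qed

text \<open>Infrequent arcs account for at most \<open>(10 * k)\<^sup>2 * p\<close> elements, half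
  of the guaranteed size of \<open>Y\<close>. A frequent arc accounts for at most
  \<open>6 * p\<close>, so at least a sixth of all arcs are frequent. The average out-degree is then
  at least \<open>10 * k / 6\<close>, more than \<open>k\<close>.\<close>

lemma star_in_frequent_types:
  fixes ty :: "'v \<Rightarrow> nat \<times> nat"
  assumes "finite Y" "p > 0" "k > 0" and ty: "ty ` Y \<subseteq> {..<10 * k} \<times> {..<10 * k}"
    and le: "\<And>e. card {x \<in> Y. ty x = e} \<le> 6 * p"
    and large: "(10 * k)\<^sup>2 * (6 * p) \<le> 3 * card Y"
  shows "\<exists>i J. J \<subseteq> {..<10 * k} \<and> i \<in> {..<10 * k} \<and> i \<notin> J \<and> card J = k \<and>
    (\<forall>j\<in>J. p \<le> card {x \<in> Y. ty x = (i, j)})"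
proof -
  define Q where "Q = {..<10 * k}"
  define A where "A = {e \<in> Q \<times> Q. p \<le> card {x \<in> Y. ty x = e}}"
  have "card Y = (\<Sum>e\<in>Q \<times> Q. card {x \<in> Y. ty x = e})"
    using sum.group[of Y "Q \<times> Q" ty "\<lambda>_. 1::nat"] assms(1) ty by (simp add: Q_def)
  also have "\<dots> \<le> (\<Sum>e\<in>Q \<times> Q. p + (if e \<in> A then 6 * p else 0))"
  proof (rule sum_mono)
    fix e assume "e \<in> Q \<times> Q"
    then show "card {x \<in> Y. ty x = e} \<le> p + (if e \<in> A then 6 * p else 0)"
      using le[of e] by (cases "e \<in> A") (simp_all add: A_def)
  qed
  also have "\<dots> = (10 * k)\<^sup>2 * p + card A * (6 * p)"
  proof -
    have "(\<Sum>e\<in>Q \<times> Q. if e \<in> A then 6 * p else 0) = (\<Sum>e\<in>(Q \<times> Q) \<inter> A. 6 * p)"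
      by (rule sum.inter_restrict[symmetric]) (simp add: Q_def)
    also have "(Q \<times> Q) \<inter> A = A" by (auto simp: A_def)
    finally show ?thesis by (simp add: sum.distrib card_cartesian_product Q_def power2_eq_square)
  qed
  finally have "card Y \<le> (10 * k)\<^sup>2 * p + 6 * (card A * p)" by (simp add: algebra_simps)
  moreover have "6 * ((10 * k)\<^sup>2 * p) \<le> 3 * card Y" using large by (simp add: algebra_simps)
  ultimately have "(10 * k)\<^sup>2 * p \<le> 6 * card A * p" by linarith
  then have A_large: "(10 * k)\<^sup>2 \<le> 6 * card A" using \<open>p > 0\<close> by simp
  have "\<exists>i\<in>Q. k < card {j \<in> Q. (i, j) \<in> A}"
  proof (rule ccontr)
    assume "\<not> ?thesis"
    then have small: "\<And>i. i \<in> Q \<Longrightarrow> card {j \<in> Q. (i, j) \<in> A} \<le> k" by force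
    have "A = (SIGMA i:Q. {j \<in> Q. (i, j) \<in> A})" by (auto simp: A_def)
    then have "card A = (\<Sum>i\<in>Q. card {j \<in> Q. (i, j) \<in> A})"
      using card_SigmaI[of Q "\<lambda>i. {j \<in> Q. (i, j) \<in> A}"] by (simp add: Q_def)
    also have "\<dots> \<le> (\<Sum>i\<in>Q. k)" by (intro sum_mono small)
    finally have "card A \<le> 10 * (k * k)" by (simp add: Q_def)
    moreover have "100 * (k * k) \<le> 6 * card A" "0 < k * k"
      using A_large \<open>k > 0\<close> by (simp_all add: power2_eq_square)
    ultimately show False by linarith
  qed
  then obtain i where i: "i \<in> Q" "k < card {j \<in> Q. (i, j) \<in> A}" by blast
  \<comment> \<open>The strict inequality pays for discarding the loop at \<open>i\<close>.\<close>
  have "k \<le> card ({j \<in> Q. (i, j) \<in> A} - {i})"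
    using i(2) by (auto simp: card_Diff_singleton_if)
  then obtain J where "J \<subseteq> {j \<in> Q. (i, j) \<in> A} - {i}" "card J = k"
    by (rule obtain_subset_with_card_n)
  then show ?thesis using i(1) unfolding Q_def A_def by blast
qed

section \<open>The size lower bound\<close>

lemma circulation_d_SDNNF_size:
  fixes ty :: "'v \<Rightarrow> nat \<times> nat"
  assumes X: "finite X" and "p > 0" "k > 0"
    and ty: "ty ` X \<subseteq> {..<10 * k} \<times> {..<10 * k}"
    and copies: "\<And>e. e \<in> {..<10 * k} \<times> {..<10 * k} \<Longrightarrow> card {x \<in> X. ty x = e} = 6 * p"
    and D: "d_SDNNF_computes D \<tau> lam (circulation_system X ty p (10 * k))"
  shows "p ^ k \<le> card (gates D)"
proof -
  let ?Q = "{..<10 * k}" and ?F = "circulation_system X ty p (10 * k)"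
  define n where "n = card X"
  have SD: "is_d_SDNNF X D \<tau> lam" and sat: "\<And>a. gate_sat D a (output_gate D) \<longleftrightarrow> system_sat ?F a"
    using D \<open>k > 0\<close> by (auto simp: d_SDNNF_computes_def system_vars_circulation)
  have "n = (\<Sum>e\<in>?Q \<times> ?Q. card {x \<in> X. ty x = e})"
    unfolding n_def using sum.group[of X "?Q \<times> ?Q" ty "\<lambda>_. 1::nat"] X ty by simp
  then have n: "n = (10 * k)\<^sup>2 * (6 * p)"
    using copies by (simp add: card_cartesian_product power2_eq_square)
  have "1 * 6 \<le> (10 * k)\<^sup>2 * (6 * p)"
    using \<open>p > 0\<close> \<open>k > 0\<close> by (intro mult_le_mono) auto
  then have "n \<ge> 2" using n by simp
  have \<tau>: "distinct (vtree_leaves \<tau>)" "set (vtree_leaves \<tau>) = X"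
    using SD by (auto simp: is_d_SDNNF_def vtree_on_def)
  then have "length (vtree_leaves \<tau>) = n" by (metis distinct_card n_def)
  then obtain t where t: "t \<in> subtrees \<tau>"
    "n \<le> 3 * length (vtree_leaves t)" "3 * length (vtree_leaves t) \<le> 2 * n"
    using balanced_subtree[of n \<tau>] \<open>n \<ge> 2\<close> by auto
  define Y where "Y = set (vtree_leaves t)"
  have YX: "Y \<subseteq> X" using subtree_leaves[OF t(1)] \<tau> by (simp add: Y_def)
  have cardY: "card Y = length (vtree_leaves t)"
    unfolding Y_def using subtree_distinct[OF t(1) \<tau>(1)] by (rule distinct_card)
  have cardZ: "card (X - Y) = n - card Y"
    using card_Diff_subset[OF finite_subset[OF YX X] YX] n_def by simp
  define A where "A S = {e \<in> ?Q \<times> ?Q. p \<le> card {x \<in> S. ty x = e}}" for S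
  have finA: "finite (A S)" for S by (simp add: A_def)
  \<comment> \<open>\<open>Z\<close> is the side that connects all vertices and \<open>W\<close> the
    one that supplies the star. Either may be the side below \<open>t\<close>, as both contain at
    least a third of the variables.\<close>
  have main: ?thesis
    if span: "\<forall>i\<in>?Q. \<forall>j\<in>?Q. spans (A Z) i j" and W: "(W = Y \<and> Z = X - Y) \<or> (W = X - Y \<and> Z = Y)"
    for W Z
  proof -
    have sub: "W \<subseteq> X" "Z \<subseteq> X" "W \<inter> Z = {}" and large: "n \<le> 3 * card W"
      using W YX t(2,3) cardY cardZ by auto
    have fin: "finite W" "finite Z" using sub X by (auto intro: finite_subset)
    have le: "card {x \<in> W. ty x = e} \<le> 6 * p" for e
    proof (cases "e \<in> ?Q \<times> ?Q")
      case True
      have "card {x \<in> W. ty x = e} \<le> card {x \<in> X. ty x = e}"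
        using sub X by (intro card_mono) auto
      then show ?thesis using copies[OF True] by simp
    next
      case False
      then have "{x \<in> W. ty x = e} = {}" using sub ty by blast
      then show ?thesis by (metis card.empty le0)
    qed
    have "ty ` W \<subseteq> ?Q \<times> ?Q" using sub(1) ty by blast
    then obtain i J where iJ: "J \<subseteq> ?Q" "i \<in> ?Q" "i \<notin> J" "card J = k"
      "\<forall>j\<in>J. p \<le> card {x \<in> W. ty x = (i, j)}"
      using star_in_frequent_types[of W p k ty] fin(1) assms(2,3) le large n by auto
    have finJ: "finite J" using iJ(1) finite_subset by blast
    define V where "V = (\<Pi>\<^sub>E j\<in>J. {..<p})"
    obtain S U where family: "\<forall>v\<in>V. S v \<subseteq> W \<and> U v \<subseteq> Z \<and>
      (\<forall>r. int p dvd (\<Sum>x\<in>S v. excess r (ty x)) + (\<Sum>x\<in>U v. excess r (ty x))) \<and>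
      (\<forall>w\<in>V. (\<forall>r\<in>J. int p dvd
        (\<Sum>x\<in>S v. excess r (ty x)) + (\<Sum>x\<in>U w. excess r (ty x))) \<longrightarrow> v = w)"
    proof -
      have "(i, j) \<in> A W" "spans (A Z) i j" if "j \<in> J" for j
        using that iJ span by (auto simp: A_def)
      moreover have "p \<le> card {x \<in> S. ty x = e}" if "e \<in> A S" for e S
        using that by (simp add: A_def)
      ultimately show thesis
        using star_fooling_family[OF fin finA finA \<open>p > 0\<close> _ _ finJ iJ(3), of W ty Z] that
        unfolding V_def by blast
    qed
    have SU: "S v \<subseteq> W" "U v \<subseteq> Z" if "v \<in> V" for v using family that by blast+
    have model: "int p dvd (\<Sum>x\<in>S v. excess r (ty x)) + (\<Sum>x\<in>U v. excess r (ty x))"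
      if "v \<in> V" for v r using family that by blast
    have fool: "v = w" if "v \<in> V" "w \<in> V" "\<forall>r\<in>J. int p dvd
        (\<Sum>x\<in>S v. excess r (ty x)) + (\<Sum>x\<in>U w. excess r (ty x))" for v w
      using family that by blast
    have sat_iff: "gate_sat D a (output_gate D) \<longleftrightarrow> (\<forall>r\<in>?Q. int p dvd
        (\<Sum>x\<in>S v. excess r (ty x)) + (\<Sum>x\<in>U w. excess r (ty x)))"
      if "v \<in> V" "w \<in> V" and a: "\<And>x. x \<in> X \<Longrightarrow> a x \<longleftrightarrow> x \<in> S v \<union> U w" for a v w
    proof -
      have "{x \<in> X. a x} = S v \<union> U w" using a SU that sub by blast
      moreover have "sum f (S v \<union> U w) = sum f (S v) + sum f (U w)" for f :: "'v \<Rightarrow> int"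
        using SU(1)[OF that(1)] SU(2)[OF that(2)] sub fin
        by (intro sum.union_disjoint) (auto intro: finite_subset)
      ultimately show ?thesis by (simp add: sat system_sat_circulation[OF X] Ball_def)
    qed
    have "card V \<le> card (gates D)"
    proof (rule d_SDNNF_fooling_set[OF SD t(1), where \<sigma> = "\<lambda>v x. x \<in> S v \<union> U v"])
      show "gate_sat D (\<lambda>x. x \<in> S v \<union> U v) (output_gate D)" if "v \<in> V" for v
        using sat_iff[OF that that, of "\<lambda>x. x \<in> S v \<union> U v"] model[OF that] by blast
    next
      fix v w assume vw: "v \<in> V" "w \<in> V"
        and g: "gate_sat D (\<lambda>x. if x \<in> set (vtree_leaves t) then x \<in> S w \<union> U w
          else x \<in> S v \<union> U v) (output_gate D)" (is "gate_sat D ?m _")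
      note s = SU(1)[OF vw(1)] SU(1)[OF vw(2)] SU(2)[OF vw(1)] SU(2)[OF vw(2)]
      \<comment> \<open>The mixture takes the side below \<open>t\<close> from \<open>w\<close>. It
        is \<open>S w\<close> with \<open>U v\<close> if that side is \<open>W\<close>, and
        \<open>S v\<close> with \<open>U w\<close> if it is \<open>Z\<close>; hence the swapped
        arguments in the first case.\<close>
      from W show "v = w"
      proof
        assume W: "W = Y \<and> Z = X - Y"
        have "?m x \<longleftrightarrow> x \<in> S w \<union> U v" if "x \<in> X" for x
          using s W by (auto simp: Y_def)
        then show ?thesis using sat_iff[OF vw(2,1), of ?m] g fool[OF vw(2,1)] iJ(1) by blast
      next
        assume W: "W = X - Y \<and> Z = Y"
        have "?m x \<longleftrightarrow> x \<in> S v \<union> U w" if "x \<in> X" for x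
          using s W by (auto simp: Y_def)
        then show ?thesis using sat_iff[OF vw, of ?m] g fool[OF vw] iJ(1) by blast
      qed
    qed
    moreover have "card V = p ^ k"
      unfolding V_def using finJ iJ(4) by (simp add: card_PiE)
    ultimately show ?thesis by simp
  qed
  \<comment> \<open>Of the \<open>6 * p\<close> copies of an arc, at least half lie on one
    side.\<close>
  have "?Q \<times> ?Q \<subseteq> A Y \<union> A (X - Y)"
  proof
    fix e assume e: "e \<in> ?Q \<times> ?Q"
    have "{x \<in> X. ty x = e} = {x \<in> Y. ty x = e} \<union> {x \<in> X - Y. ty x = e}" using YX by blast
    then have "card {x \<in> X. ty x = e} \<le> card {x \<in> Y. ty x = e} + card {x \<in> X - Y. ty x = e}"
      using card_Un_le[of "{x \<in> Y. ty x = e}" "{x \<in> X - Y. ty x = e}"] by (simp only:)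
    then have "p \<le> card {x \<in> Y. ty x = e} \<or> p \<le> card {x \<in> X - Y. ty x = e}"
      unfolding copies[OF e] using \<open>p > 0\<close> by linarith
    then show "e \<in> A Y \<union> A (X - Y)" using e by (auto simp: A_def)
  qed
  from spans_dichotomy[OF finA finA this] show ?thesis
    using main by blast
qed

theorem theorem5:
  "\<exists>(A::nat) (B::nat) (\<epsilon>::real). \<epsilon> > 0 \<and>
     (\<forall>k::nat. k \<ge> 1 \<longrightarrow> (\<forall>N::nat. \<exists>n\<ge>N. \<exists>F :: nat constraint set.
        is_system F \<and> card (system_vars F) = n \<and> (\<exists>a. system_sat F a) \<and>
        incidence_treewidth F \<le> A * k \<and>
        (\<forall>(D :: (nat, nat) circuit) \<tau> lam. d_SDNNF_computes D \<tau> lam F \<longrightarrow>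
           real (circuit_size D) \<ge> (real n / real k) powr (\<epsilon> * real k)) \<and>
        (\<forall>c\<in>F. slim_for_OBDDs (B * n * k) c)))"
\<comment> \<open>There are at most \<open>10 * k\<close> constraints, the width \<open>p\<close> is
  at most \<open>n\<close>, and \<open>n / k \<le> p\<^sup>2\<close> turns the bound
  \<open>p ^ k\<close> into exponent \<open>k / 2\<close>.\<close>
proof (rule exI[of _ 10], rule exI[of _ 1], rule exI[of _ "1/2"], intro conjI allI impI)
  fix k N :: nat assume k: "k \<ge> 1"
  \<comment> \<open>\<open>N\<close> makes \<open>n\<close> large enough; \<open>600 * k\<close>
    gives \<open>n / k = 600 * k * p \<le> p * p\<close>.\<close>
  define p where "p = N + 600 * k"
  have p: "p > 0" "p \<ge> N" "p \<ge> 600 * k" using k by (auto simp: p_def)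
  let ?Q = "{..<10 * k}"
  \<comment> \<open>The variables must be natural numbers: \<open>enc (e, l)\<close> is the copy
    \<open>l\<close> of the arc \<open>e\<close>, and \<open>ty\<close> recovers the arc.\<close>
  define enc where "enc = (\<lambda>(e, l). prod_encode (prod_encode e, l))"
  define ty where "ty x = prod_decode (fst (prod_decode x))" for x
  have ty_enc: "ty (enc (e, l)) = e" for e l by (simp add: ty_def enc_def)
  have inj: "inj enc" by (auto simp: inj_def enc_def)
  define X where "X = enc ` ((?Q \<times> ?Q) \<times> {..<6 * p})"
  have finX: "finite X" by (simp add: X_def)
  define n where "n = card X"
  have n: "n = 600 * k * k * p"
    unfolding n_def X_def
    by (subst card_image) (auto intro: inj_on_subset[OF inj] simp: card_cartesian_product)
  have ty: "ty ` X \<subseteq> ?Q \<times> ?Q" by (auto simp: X_def ty_enc)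
  have copies: "card {x \<in> X. ty x = e} = 6 * p" if "e \<in> ?Q \<times> ?Q" for e
  proof -
    have "{x \<in> X. ty x = e} = enc ` ({e} \<times> {..<6 * p})"
      using that by (auto simp: X_def ty_enc)
    then show ?thesis
      by (simp add: card_image inj_on_subset[OF inj] card_cartesian_product)
  qed
  define F where "F = circulation_system X ty p (10 * k)"
  have sys: "is_system F" unfolding F_def by (rule is_system_circulation[OF finX])
  have "p \<le> n" using k by (simp add: n)
  show "\<exists>n\<ge>N. \<exists>F :: nat constraint set.
        is_system F \<and> card (system_vars F) = n \<and> (\<exists>a. system_sat F a) \<and>
        incidence_treewidth F \<le> 10 * k \<and>
        (\<forall>(D :: (nat, nat) circuit) \<tau> lam. d_SDNNF_computes D \<tau> lam F \<longrightarrow>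
           real (circuit_size D) \<ge> (real n / real k) powr (1/2 * real k)) \<and>
        (\<forall>c\<in>F. slim_for_OBDDs (1 * n * k) c)"
  proof (intro exI[of _ n] exI[of _ F] conjI allI impI ballI)
    show "N \<le> n" using p \<open>p \<le> n\<close> by simp
    show "is_system F" by (rule sys)
    show "card (system_vars F) = n" using k by (simp add: F_def system_vars_circulation n_def)
    \<comment> \<open>The empty selection is a circulation. This excludes the degenerate case of an
      unsatisfiable system, which no circuit computes.\<close>
    show "\<exists>a. system_sat F a"
      unfolding F_def by (intro exI[of _ "\<lambda>_. False"]) (simp add: system_sat_circulation[OF finX])
    have "card F \<le> 10 * k"
      unfolding F_def circulation_system_def using card_image_le[of "{..<10 * k}"] by fastforce
    then show "incidence_treewidth F \<le> 10 * k"
      using incidence_treewidth_le_card[OF sys] by simp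
  next
    fix D :: "(nat, nat) circuit" and \<tau> lam assume D: "d_SDNNF_computes D \<tau> lam F"
    have size: "p ^ k \<le> circuit_size D"
      using circulation_d_SDNNF_size[OF finX p(1) _ ty copies D[unfolded F_def]] k
      by (simp add: circuit_size_def)
    have "real n / real k = 600 * real k * real p" using k by (simp add: n field_simps)
    also have "\<dots> \<le> real p * real p"
      using p(3) by (intro mult_right_mono) (auto simp: of_nat_mono simp flip: of_nat_mult)
    also have "\<dots> = real p powr 2" using p by (simp add: power2_eq_square)
    finally have "(real n / real k) powr (1/2 * real k) \<le> (real p powr 2) powr (1/2 * real k)"
      by (intro powr_mono2) auto
    also have "\<dots> = real (p ^ k)" using p(1) by (simp only: powr_powr) (simp add: powr_realpow)
    also have "\<dots> \<le> real (circuit_size D)" using size by (simp only: of_nat_le_iff)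
    finally show "(real n / real k) powr (1/2 * real k) \<le> real (circuit_size D)" .
  next
    fix c assume "c \<in> F"
    then have "slim_for_OBDDs p c" unfolding F_def by (rule slim_circulation[OF p(1)])
    moreover have "p \<le> 1 * n * k" using \<open>p \<le> n\<close> k by (simp add: trans_le_add1 le_trans)
    ultimately show "slim_for_OBDDs (1 * n * k) c"
      unfolding slim_for_OBDDs_def by (meson le_trans)
  qed
qed simp

end
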